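(* Let $A$ be a commutative ring with nonzero identity, let $M$ be an $A$-module and let $S$ be a classical 1-absorbing prime m-closed set (a subset of $M\setminus\{0\}$). Then the set of all submodules of $M$ which are disjoint from $S$ has at least one maximal element. Any such maximal element is a classical 1-absorbing prime submodule of $M$.
   Context: All rings are commutative with nonzero identity and all modules are nonzero and unital. A proper submodule $P$ of an $A$-module $M$ is a classical 1-absorbing prime submodule if whenever $abcm\in P$ for some nonunits $a,b,c\in A$ and $m\in M$, then $abm\in P$ or $cm\in P$. Let $S$ be a subset of $M\setminus\{0\}$. If for all proper ideals $I,J,K$ of $A$ and all submodules $L,N$ of $M$, $(N+IJL)\cap S\neq\emptyset$ and $(N+KL)\cap S\neq\emptyset$ imply $(N+IJKL)\cap S\neq\emptyset$, then $S$ is said to be a classical 1-absorbing prime m-closed set. Maximality is with respect to inclusion.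
   Formalization: The second claim is stated only for nonempty S: the empty set is vacuously m-closed, and the only maximal submodule disjoint from it is M itself, which is not proper and hence not classical 1-absorbing prime. Existence is stated for every S. *)

theory Defs
  imports "HOL-Algebra.Module" "HOL-Algebra.Ideal_Product"
begin

text \<open>
  The product \<open>I L\<close> of an ideal and a submodule: all finite sums of elements \<open>i l\<close>.  As for the
  library's product of ideals, no separate rule for \<open>0\<close> is needed, because \<open>0 = 0 \<cdot> 0\<close>; the lemmas
  below identify it as the least submodule containing all the products \<open>i l\<close>.
\<close>

inductive_set ideal_smult :: "('a, 'b, 'm) module_scheme \<Rightarrow> 'a set \<Rightarrow> 'b set \<Rightarrow> 'b set"
  for M and I and L where
    smult: "\<lbrakk> i \<in> I; l \<in> L \<rbrakk> \<Longrightarrow> i \<odot>\<^bsub>M\<^esub> l \<in> ideal_smult M I L"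
  | sum: "\<lbrakk> x \<in> ideal_smult M I L; y \<in> ideal_smult M I L \<rbrakk> \<Longrightarrow> x \<oplus>\<^bsub>M\<^esub> y \<in> ideal_smult M I L"

lemma (in module) ideal_smult_is_submodule:
  assumes "ideal I R" "submodule L R M"
  shows "submodule (ideal_smult M I L) R M"
proof -
  interpret I: ideal I R by fact
  have Lc: "l \<in> carrier M" if "l \<in> L" for l
    using submoduleE(1)[OF assms(2)] that by blast
  have car: "x \<in> carrier M" if "x \<in> ideal_smult M I L" for x
    using that by induction (auto intro: I.Icarr Lc)
  have sm: "r \<odot>\<^bsub>M\<^esub> x \<in> ideal_smult M I L" if "x \<in> ideal_smult M I L" "r \<in> carrier R" for r x
    using that
  proof induction
    case (smult i l)
    then have "r \<odot>\<^bsub>M\<^esub> (i \<odot>\<^bsub>M\<^esub> l) = (r \<otimes> i) \<odot>\<^bsub>M\<^esub> l"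
      by (simp add: smult_assoc1 I.Icarr Lc)
    then show ?case
      using smult by (auto intro: ideal_smult.smult I.I_l_closed)
  next
    case (sum x y)
    then show ?case
      by (simp add: smult_r_distr car ideal_smult.sum)
  qed
  obtain l where l: "l \<in> L" using submoduleE(2)[OF assms(2)] by blast
  show ?thesis
  proof (rule submoduleI)
    show "ideal_smult M I L \<subseteq> carrier M" using car by blast
    show "\<zero>\<^bsub>M\<^esub> \<in> ideal_smult M I L"
      using ideal_smult.smult[of \<zero> I l L M] l by (simp add: Lc)
    fix x y assume "x \<in> ideal_smult M I L"
    then show "\<ominus>\<^bsub>M\<^esub> x \<in> ideal_smult M I L"
      using sm[of x "\<ominus> \<one>"] by (simp add: smult_l_minus car)
  qed (auto intro: ideal_smult.sum sm)
qed

lemma (in module) ideal_smult_least: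
  assumes "submodule N R M" "\<And>i l. \<lbrakk> i \<in> I; l \<in> L \<rbrakk> \<Longrightarrow> i \<odot>\<^bsub>M\<^esub> l \<in> N"
  shows "ideal_smult M I L \<subseteq> N"
proof
  fix x assume "x \<in> ideal_smult M I L"
  then show "x \<in> N"
    by induction (auto intro: assms(2) submoduleE(5)[OF assms(1)])
qed

definition classical_1_absorbing_prime ::
  "('a, 'r) ring_scheme \<Rightarrow> ('a, 'b, 'm) module_scheme \<Rightarrow> 'b set \<Rightarrow> bool" where
  "classical_1_absorbing_prime A M P \<longleftrightarrow>
     submodule P A M \<and> P \<noteq> carrier M \<and>
     (\<forall>a \<in> carrier A - Units A. \<forall>b \<in> carrier A - Units A. \<forall>c \<in> carrier A - Units A.
      \<forall>m \<in> carrier M.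
        (a \<otimes>\<^bsub>A\<^esub> b \<otimes>\<^bsub>A\<^esub> c) \<odot>\<^bsub>M\<^esub> m \<in> P \<longrightarrow>
        (a \<otimes>\<^bsub>A\<^esub> b) \<odot>\<^bsub>M\<^esub> m \<in> P \<or> c \<odot>\<^bsub>M\<^esub> m \<in> P)"

definition proper_ideal :: "('a, 'r) ring_scheme \<Rightarrow> 'a set \<Rightarrow> bool" where
  "proper_ideal A I \<longleftrightarrow> ideal I A \<and> I \<noteq> carrier A"

definition classical_1_absorbing_prime_m_closed ::
  "('a, 'r) ring_scheme \<Rightarrow> ('a, 'b, 'm) module_scheme \<Rightarrow> 'b set \<Rightarrow> bool" where
  "classical_1_absorbing_prime_m_closed A M S \<longleftrightarrow>
     S \<subseteq> carrier M - {\<zero>\<^bsub>M\<^esub>} \<and>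
     (\<forall>I J K L N.
        proper_ideal A I \<longrightarrow> proper_ideal A J \<longrightarrow> proper_ideal A K \<longrightarrow>
        submodule L A M \<longrightarrow> submodule N A M \<longrightarrow>
        (N <+>\<^bsub>M\<^esub> ideal_smult M (I \<cdot>\<^bsub>A\<^esub> J) L) \<inter> S \<noteq> {} \<longrightarrow>
        (N <+>\<^bsub>M\<^esub> ideal_smult M K L) \<inter> S \<noteq> {} \<longrightarrow>
        (N <+>\<^bsub>M\<^esub> ideal_smult M (I \<cdot>\<^bsub>A\<^esub> J \<cdot>\<^bsub>A\<^esub> K) L) \<inter> S \<noteq> {})"

definition disjoint_submodules ::
  "('a, 'r) ring_scheme \<Rightarrow> ('a, 'b, 'm) module_scheme \<Rightarrow> 'b set \<Rightarrow> 'b set set" where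
  "disjoint_submodules A M S = {N. submodule N A M \<and> N \<inter> S = {}}"

definition inclusion_maximal :: "'b set set \<Rightarrow> 'b set \<Rightarrow> bool" where
  "inclusion_maximal \<N> P \<longleftrightarrow> P \<in> \<N> \<and> (\<forall>Q \<in> \<N>. P \<subseteq> Q \<longrightarrow> Q = P)"

end

theory Submission
  imports Defs
begin

text \<open>
  Maximal submodules disjoint from \<open>S\<close> exist by Zorn's lemma: the zero submodule avoids \<open>S\<close>, and
  the union of a nonempty chain of submodules avoiding \<open>S\<close> is again one.

  A maximal such \<open>P\<close> is proper as soon as \<open>S\<close> is nonempty; for \<open>S = {}\<close> it would be all of
  \<open>M\<close>.  Maximality of \<open>P\<close> means that every submodule strictly containing \<open>P\<close> meets \<open>S\<close>.  Suppose that
  \<open>abm\<close> and \<open>cm\<close> lie outside \<open>P\<close> for nonunits \<open>a, b, c\<close>.  The principal ideals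
  \<open>I = (a)\<close>, \<open>J = (b)\<close>, \<open>K = (c)\<close> are proper and, with \<open>L = Am\<close>, both \<open>P + IJL\<close> and \<open>P + KL\<close>
  are strictly larger than \<open>P\<close>, so both meet \<open>S\<close>; m-closedness, applied with \<open>N = P\<close>, makes
  \<open>P + IJKL\<close> meet \<open>S\<close> too.  But \<open>IJKL\<close> is the cyclic submodule generated by \<open>abcm\<close>, so
  \<open>abcm \<in> P\<close> would give \<open>P + IJKL \<subseteq> P\<close>, which avoids \<open>S\<close>.  What makes this a computation with
  elements is that products of principal ideals are principal (\<open>ideal_prod_PIdl\<close>) and that a
  principal ideal times a cyclic submodule lies in any submodule containing the product of the
  generators (\<open>ideal_smult_PIdl_cyclic_subset\<close>).
\<close>

lemma (in module) zero_submodule: "submodule {\<zero>\<^bsub>M\<^esub>} R M"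
  by (rule submoduleI) auto

lemma (in module) zero_in_submodule:
  assumes "submodule N R M"
  shows "\<zero>\<^bsub>M\<^esub> \<in> N"
  using subgroup.one_closed[OF submodule.axioms(1)[OF assms]] by simp

lemma (in module) cyclic_submodule:
  assumes m: "m \<in> carrier M"
  shows "submodule ((\<lambda>r. r \<odot>\<^bsub>M\<^esub> m) ` carrier R) R M"
proof (rule submoduleI)
  show "(\<lambda>r. r \<odot>\<^bsub>M\<^esub> m) ` carrier R \<subseteq> carrier M" using m by auto
  show "\<zero>\<^bsub>M\<^esub> \<in> (\<lambda>r. r \<odot>\<^bsub>M\<^esub> m) ` carrier R"
    using m by (intro image_eqI[of _ _ \<zero>]) auto
next
  fix x assume "x \<in> (\<lambda>r. r \<odot>\<^bsub>M\<^esub> m) ` carrier R"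
  then obtain r where "r \<in> carrier R" "x = r \<odot>\<^bsub>M\<^esub> m" by blast
  then show "\<ominus>\<^bsub>M\<^esub> x \<in> (\<lambda>r. r \<odot>\<^bsub>M\<^esub> m) ` carrier R"
    using m by (intro image_eqI[of _ _ "\<ominus> r"]) (auto simp: smult_l_minus)
next
  fix x y assume "x \<in> (\<lambda>r. r \<odot>\<^bsub>M\<^esub> m) ` carrier R" "y \<in> (\<lambda>r. r \<odot>\<^bsub>M\<^esub> m) ` carrier R"
  then obtain r s where "r \<in> carrier R" "x = r \<odot>\<^bsub>M\<^esub> m" "s \<in> carrier R" "y = s \<odot>\<^bsub>M\<^esub> m" by blast
  then show "x \<oplus>\<^bsub>M\<^esub> y \<in> (\<lambda>r. r \<odot>\<^bsub>M\<^esub> m) ` carrier R"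
    using m by (intro image_eqI[of _ _ "r \<oplus> s"]) (auto simp: smult_l_distr)
next
  fix a x assume "a \<in> carrier R" "x \<in> (\<lambda>r. r \<odot>\<^bsub>M\<^esub> m) ` carrier R"
  then obtain r where "r \<in> carrier R" "x = r \<odot>\<^bsub>M\<^esub> m" "a \<in> carrier R" by blast
  then show "a \<odot>\<^bsub>M\<^esub> x \<in> (\<lambda>r. r \<odot>\<^bsub>M\<^esub> m) ` carrier R"
    using m by (intro image_eqI[of _ _ "a \<otimes> r"]) (auto simp: smult_assoc1)
qed

lemma (in module) submodule_set_add:
  assumes N: "submodule N R M" and L: "submodule L R M"
  shows "submodule (N <+>\<^bsub>M\<^esub> L) R M"
proof (intro submodule.intro submodule_axioms.intro)
  show "subgroup (N <+>\<^bsub>M\<^esub> L) (add_monoid M)"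
    unfolding set_add_def
    using comm_group.mult_subgroups[OF a_comm_group] N L by (blast dest: submodule.axioms(1))
  fix a x assume a: "a \<in> carrier R" and "x \<in> N <+>\<^bsub>M\<^esub> L"
  then obtain n l where nl: "n \<in> N" "l \<in> L" and x: "x = n \<oplus>\<^bsub>M\<^esub> l"
    unfolding set_add_def' by blast
  have "a \<odot>\<^bsub>M\<^esub> x = a \<odot>\<^bsub>M\<^esub> n \<oplus>\<^bsub>M\<^esub> a \<odot>\<^bsub>M\<^esub> l"
    using a nl submoduleE(1)[OF N] submoduleE(1)[OF L] by (simp add: x smult_r_distr subset_iff)
  moreover have "a \<odot>\<^bsub>M\<^esub> n \<in> N" "a \<odot>\<^bsub>M\<^esub> l \<in> L"
    using a nl submoduleE(4)[OF N] submoduleE(4)[OF L] by auto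
  ultimately show "a \<odot>\<^bsub>M\<^esub> x \<in> N <+>\<^bsub>M\<^esub> L"
    unfolding set_add_def' by blast
qed

lemma (in module) set_add_upper:
  assumes N: "submodule N R M" and L: "submodule L R M"
  shows "N \<subseteq> N <+>\<^bsub>M\<^esub> L" and "L \<subseteq> N <+>\<^bsub>M\<^esub> L"
proof -
  show "N \<subseteq> N <+>\<^bsub>M\<^esub> L"
  proof
    fix n assume n: "n \<in> N"
    then have "n = n \<oplus>\<^bsub>M\<^esub> \<zero>\<^bsub>M\<^esub>" using submoduleE(1)[OF N] by auto
    then show "n \<in> N <+>\<^bsub>M\<^esub> L" using n zero_in_submodule[OF L] unfolding set_add_def' by blast
  qed
  show "L \<subseteq> N <+>\<^bsub>M\<^esub> L"
  proof
    fix l assume l: "l \<in> L"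
    then have "l = \<zero>\<^bsub>M\<^esub> \<oplus>\<^bsub>M\<^esub> l" using submoduleE(1)[OF L] by auto
    then show "l \<in> N <+>\<^bsub>M\<^esub> L" using l zero_in_submodule[OF N] unfolding set_add_def' by blast
  qed
qed

lemma (in module) submodule_Union_chain:
  assumes "\<C> \<noteq> {}" and chain: "subset.chain {N. submodule N R M} \<C>"
  shows "submodule (\<Union>\<C>) R M"
proof (rule submoduleI)
  have sub: "submodule N R M" if "N \<in> \<C>" for N
    using chain that unfolding subset.chain_def by blast
  show "\<Union>\<C> \<subseteq> carrier M" by (intro Union_least submoduleE(1)[OF sub])
  show "\<zero>\<^bsub>M\<^esub> \<in> \<Union>\<C>" using zero_in_submodule[OF sub] \<open>\<C> \<noteq> {}\<close> by blast
  show "\<ominus>\<^bsub>M\<^esub> x \<in> \<Union>\<C>" if "x \<in> \<Union>\<C>" for x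
    using that submoduleE(3)[OF sub] by blast
  show "a \<odot>\<^bsub>M\<^esub> x \<in> \<Union>\<C>" if "a \<in> carrier R" "x \<in> \<Union>\<C>" for a x
    using that submoduleE(4)[OF sub] by blast
  fix x y assume "x \<in> \<Union>\<C>" "y \<in> \<Union>\<C>"
  then obtain X Y where "X \<in> \<C>" "Y \<in> \<C>" "x \<in> X" "y \<in> Y" by blast
  moreover from this chain have "X \<subseteq> Y \<or> Y \<subseteq> X"
    unfolding subset_chain_def by blast
  ultimately obtain Z where "Z \<in> \<C>" "x \<in> Z" "y \<in> Z" by blast
  then show "x \<oplus>\<^bsub>M\<^esub> y \<in> \<Union>\<C>" using submoduleE(5)[OF sub] by blast
qed

lemma (in module) exists_maximal_disjoint_submodule:
  assumes "\<zero>\<^bsub>M\<^esub> \<notin> S"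
  shows "\<exists>P. inclusion_maximal (disjoint_submodules R M S) P"
proof -
  have "\<exists>P\<in>disjoint_submodules R M S. \<forall>Q\<in>disjoint_submodules R M S. P \<subseteq> Q \<longrightarrow> Q = P"
  proof (rule subset_Zorn_nonempty)
    show "disjoint_submodules R M S \<noteq> {}"
      using zero_submodule assms unfolding disjoint_submodules_def by blast
    fix \<C> assume ne: "\<C> \<noteq> {}" and chain: "subset.chain (disjoint_submodules R M S) \<C>"
    then have "subset.chain {N. submodule N R M} \<C>"
      unfolding subset_chain_def disjoint_submodules_def by blast
    from submodule_Union_chain[OF ne this] chain
    show "\<Union>\<C> \<in> disjoint_submodules R M S"
      unfolding subset_chain_def disjoint_submodules_def by blast
  qed
  then show ?thesis unfolding inclusion_maximal_def by blast
qed

lemma (in module) meets_if_above_maximal: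
  assumes max: "inclusion_maximal (disjoint_submodules R M S) P"
    and L: "submodule L R M" and x: "x \<in> L" "x \<notin> P"
  shows "(P <+>\<^bsub>M\<^esub> L) \<inter> S \<noteq> {}"
proof
  assume dis: "(P <+>\<^bsub>M\<^esub> L) \<inter> S = {}"
  have P: "submodule P R M"
    using max unfolding inclusion_maximal_def disjoint_submodules_def by blast
  have "P <+>\<^bsub>M\<^esub> L = P"
    using max dis submodule_set_add[OF P L] set_add_upper(1)[OF P L]
    unfolding inclusion_maximal_def disjoint_submodules_def by blast
  with x set_add_upper(2)[OF P L] show False by blast
qed

lemma (in cring) proper_ideal_PIdl:
  assumes a: "a \<in> carrier R - Units R"
  shows "proper_ideal R (PIdl a)"
proof -
  have "\<one> \<notin> PIdl a"
  proof
    assume "\<one> \<in> PIdl a"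
    then obtain r where "r \<in> carrier R" "r \<otimes> a = \<one>" unfolding cgenideal_def by auto
    then have "a \<in> Units R" using a m_comm unfolding Units_def by auto
    with a show False by blast
  qed
  then show ?thesis using a cgenideal_ideal unfolding proper_ideal_def by auto
qed

text \<open>
  The elementwise product of \<open>(a)\<close> and \<open>(b)\<close> is already the ideal \<open>(ab)\<close>, so passing to finite
  sums adds nothing.
\<close>
lemma (in cring) ideal_prod_PIdl:
  assumes "a \<in> carrier R" "b \<in> carrier R"
  shows "(PIdl a) \<cdot> (PIdl b) = PIdl (a \<otimes> b)"
proof -
  have I: "ideal (PIdl (a \<otimes> b)) R" using assms by (simp add: cgenideal_ideal)
  have "(PIdl a) \<cdot> (PIdl b) = Idl (PIdl (a \<otimes> b))"
    using assms by (simp add: ideal_prod_eq_genideal cgenideal_ideal cgenideal_prod)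
  also have "\<dots> = PIdl (a \<otimes> b)"
    using genideal_minimal[OF I subset_refl] genideal_self ideal.Icarr[OF I]
    by (simp add: subset_antisym subsetI)
  finally show ?thesis .
qed

lemma (in module) smult_in_ideal_smult_PIdl_cyclic:
  assumes "x \<in> carrier R" "m \<in> carrier M"
  shows "x \<odot>\<^bsub>M\<^esub> m \<in> ideal_smult M (PIdl x) ((\<lambda>r. r \<odot>\<^bsub>M\<^esub> m) ` carrier R)"
proof (rule ideal_smult.smult)
  show "x \<in> PIdl x" using assms by (simp add: cgenideal_self)
  show "m \<in> (\<lambda>r. r \<odot>\<^bsub>M\<^esub> m) ` carrier R"
    using assms by (intro image_eqI[of _ _ \<one>]) auto
qed

text \<open>
  By commutativity \<open>(sx)(rm) = (sr)(xm)\<close>, so each generator of \<open>(x) \<cdot> Rm\<close> is a multiple of \<open>xm\<close>.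
\<close>
lemma (in module) ideal_smult_PIdl_cyclic_subset:
  assumes x: "x \<in> carrier R" and m: "m \<in> carrier M"
    and P: "submodule P R M" and xm: "x \<odot>\<^bsub>M\<^esub> m \<in> P"
  shows "ideal_smult M (PIdl x) ((\<lambda>r. r \<odot>\<^bsub>M\<^esub> m) ` carrier R) \<subseteq> P"
proof (rule ideal_smult_least[OF P])
  fix i l assume "i \<in> PIdl x" "l \<in> (\<lambda>r. r \<odot>\<^bsub>M\<^esub> m) ` carrier R"
  then obtain s r where sr: "s \<in> carrier R" "r \<in> carrier R"
    and il: "i = s \<otimes> x" "l = r \<odot>\<^bsub>M\<^esub> m"
    unfolding cgenideal_def by blast
  have "i \<odot>\<^bsub>M\<^esub> l = (s \<otimes> x \<otimes> r) \<odot>\<^bsub>M\<^esub> m"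
    using sr x m by (simp add: il smult_assoc1)
  also have "s \<otimes> x \<otimes> r = s \<otimes> r \<otimes> x"
    using sr x by (simp add: R.m_ac)
  also have "(s \<otimes> r \<otimes> x) \<odot>\<^bsub>M\<^esub> m = (s \<otimes> r) \<odot>\<^bsub>M\<^esub> (x \<odot>\<^bsub>M\<^esub> m)"
    using sr x m by (simp add: smult_assoc1)
  finally show "i \<odot>\<^bsub>M\<^esub> l \<in> P" using submoduleE(4)[OF P] sr xm by simp
qed

lemma (in module) maximal_disjoint_is_classical_1_absorbing_prime:
  assumes closed: "classical_1_absorbing_prime_m_closed R M S" and "S \<noteq> {}"
    and max: "inclusion_maximal (disjoint_submodules R M S) P"
  shows "classical_1_absorbing_prime R M P"
proof -
  have P: "submodule P R M" and dis: "P \<inter> S = {}"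
    using max unfolding inclusion_maximal_def disjoint_submodules_def by auto
  have "S \<subseteq> carrier M"
    using closed unfolding classical_1_absorbing_prime_m_closed_def by blast
  with \<open>S \<noteq> {}\<close> dis have proper: "P \<noteq> carrier M" by blast
  have "(a \<otimes> b) \<odot>\<^bsub>M\<^esub> m \<in> P \<or> c \<odot>\<^bsub>M\<^esub> m \<in> P"
    if a: "a \<in> carrier R - Units R" and b: "b \<in> carrier R - Units R"
      and c: "c \<in> carrier R - Units R" and m: "m \<in> carrier M"
      and abcm: "(a \<otimes> b \<otimes> c) \<odot>\<^bsub>M\<^esub> m \<in> P" for a b c m
  proof (rule ccontr)
    assume "\<not> ?thesis"
    then have abm: "(a \<otimes> b) \<odot>\<^bsub>M\<^esub> m \<notin> P" and cm: "c \<odot>\<^bsub>M\<^esub> m \<notin> P" by auto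
    define L where "L = (\<lambda>r. r \<odot>\<^bsub>M\<^esub> m) ` carrier R"
    have L: "submodule L R M" unfolding L_def by (rule cyclic_submodule[OF m])
    have meets: "(P <+>\<^bsub>M\<^esub> ideal_smult M (PIdl x) L) \<inter> S \<noteq> {}"
      if "x \<in> carrier R" "x \<odot>\<^bsub>M\<^esub> m \<notin> P" for x
      using smult_in_ideal_smult_PIdl_cyclic[OF that(1) m] that(2)
      by (intro meets_if_above_maximal[OF max ideal_smult_is_submodule[OF _ L]])
        (auto simp: L_def that(1) R.cgenideal_ideal)
    have IJ: "(PIdl a) \<cdot> (PIdl b) = PIdl (a \<otimes> b)"
      and IJK: "(PIdl a) \<cdot> (PIdl b) \<cdot> (PIdl c) = PIdl (a \<otimes> b \<otimes> c)"
      using a b c by (simp_all add: R.ideal_prod_PIdl)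
    have "(P <+>\<^bsub>M\<^esub> ideal_smult M ((PIdl a) \<cdot> (PIdl b)) L) \<inter> S \<noteq> {}"
      unfolding IJ using a b abm by (intro meets) auto
    moreover have "(P <+>\<^bsub>M\<^esub> ideal_smult M (PIdl c) L) \<inter> S \<noteq> {}"
      using c cm by (intro meets) auto
    ultimately have "(P <+>\<^bsub>M\<^esub> ideal_smult M ((PIdl a) \<cdot> (PIdl b) \<cdot> (PIdl c)) L) \<inter> S \<noteq> {}"
      by (rule closed[unfolded classical_1_absorbing_prime_m_closed_def, THEN conjunct2,
            rule_format, OF R.proper_ideal_PIdl[OF a] R.proper_ideal_PIdl[OF b]
            R.proper_ideal_PIdl[OF c] L P])
    moreover have "ideal_smult M (PIdl (a \<otimes> b \<otimes> c)) L \<subseteq> P"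
      unfolding L_def using a b c by (intro ideal_smult_PIdl_cyclic_subset m P abcm) auto
    then have "P <+>\<^bsub>M\<^esub> ideal_smult M (PIdl (a \<otimes> b \<otimes> c)) L \<subseteq> P"
      unfolding set_add_def' using submoduleE(5)[OF P] by blast
    ultimately show False using dis unfolding IJK by blast
  qed
  with P proper show ?thesis unfolding classical_1_absorbing_prime_def by blast
qed

theorem theorem6:
  fixes A :: "('a, 'r) ring_scheme" and M :: "('a, 'b, 'm) module_scheme" and S :: "'b set"
  assumes "module A M"
    and "\<one>\<^bsub>A\<^esub> \<noteq> \<zero>\<^bsub>A\<^esub>"
    and "carrier M \<noteq> {\<zero>\<^bsub>M\<^esub>}"
    and "classical_1_absorbing_prime_m_closed A M S"
  shows "(\<exists>P. inclusion_maximal (disjoint_submodules A M S) P) \<and>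
         (S \<noteq> {} \<longrightarrow>
            (\<forall>P. inclusion_maximal (disjoint_submodules A M S) P \<longrightarrow>
                 classical_1_absorbing_prime A M P))"

proof -
  interpret module A M by fact
  have "\<zero>\<^bsub>M\<^esub> \<notin> S"
    using assms(4) unfolding classical_1_absorbing_prime_m_closed_def by blast
  then show ?thesis
    using exists_maximal_disjoint_submodule
      maximal_disjoint_is_classical_1_absorbing_prime[OF assms(4)] by blast
qed

end
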